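(* Let $\mathcal{D}_G$ be a class of probability distributions (generator class), $\mathcal{F}_D$ a class of real-valued functions (discriminator class), $\nu$ the target distribution and $\nu_n$ some estimate of $\nu$ based on $n$ i.i.d. samples from $\nu$. Let $$\mu_n=\operatorname*{arg\,min}_{\mu\in\mathcal{D}_G}\ \max_{f\in\mathcal{F}_D}\Big\{\mathbb{E}_{Y\sim\mu}f(Y)-\mathbb{E}_{X\sim\nu_n}f(X)\Big\}.$$ If $\mathcal{F}_D$ is symmetric, $\mathcal{F}_D=-\mathcal{F}_D$, then $$d_{\mathcal{F}_D}(\nu,\mu_n)\ \le\ \min_{\mu\in\mathcal{D}_G}d_{\mathcal{F}_D}(\mu,\nu)+2\,d_{\mathcal{F}_D}(\nu,\nu_n).$$
   Context: $d_{\mathcal{F}}(\mu,\nu)=\sup_{f\in\mathcal{F}}\{\mathbb{E}_{Y\sim\mu}f(Y)-\mathbb{E}_{X\sim\nu}f(X)\}$. The inequality is deterministic (it holds for every realization of $\nu_n$). *)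

theory Defs
  imports "HOL-Probability.Probability"
begin

text \<open>The supremum is taken in the extended reals: no boundedness of the function class is assumed,
  so the value may be \<open>\<infinity>\<close>.\<close>

definition adv_dist :: "('a \<Rightarrow> real) set \<Rightarrow> 'a measure \<Rightarrow> 'a measure \<Rightarrow> ereal"
  where "adv_dist F \<mu> \<nu> = (SUP f\<in>F. ereal ((LINT y|\<mu>. f y) - (LINT x|\<nu>. f x)))"

end

theory Submission
  imports Defs
begin

text \<open>
  Because the supremum defining the adversarial distance is subadditive, the distance obeys the
  triangle inequality, and a class closed under negation makes it symmetric in its two measures.
  For an arbitrary competitor \<open>\<mu>\<close> the trained generator is then controlled by passing through the
  estimate twice:
  \<open>d(\<nu>,\<mu>\<^sub>n) \<le> d(\<nu>,\<nu>\<^sub>n) + d(\<mu>\<^sub>n,\<nu>\<^sub>n) \<le> d(\<nu>,\<nu>\<^sub>n) + d(\<mu>,\<nu>\<^sub>n) \<le> d(\<mu>,\<nu>) + 2 d(\<nu>,\<nu>\<^sub>n)\<close>,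
  where the middle step is the optimality of \<open>\<mu>\<^sub>n\<close>. It remains to take the infimum over \<open>\<mu>\<close>. Since
  distances may be infinite, pulling the constant out of the infimum uses that the distances are
  nonnegative, which again comes from closure under negation, except for the empty class, whose
  distances are all \<open>-\<infinity>\<close>.
\<close>

lemma adv_dist_triangle: "adv_dist F \<mu> \<rho> \<le> adv_dist F \<mu> \<nu> + adv_dist F \<nu> \<rho>"
  unfolding adv_dist_def
proof (rule SUP_least)
  fix f assume f: "f \<in> F"
  have "ereal ((LINT y|\<mu>. f y) - (LINT x|\<rho>. f x))
      = ereal ((LINT y|\<mu>. f y) - (LINT x|\<nu>. f x)) + ereal ((LINT y|\<nu>. f y) - (LINT x|\<rho>. f x))"
    by simp
  also have "\<dots> \<le> (SUP f\<in>F. ereal ((LINT y|\<mu>. f y) - (LINT x|\<nu>. f x)))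
      + (SUP f\<in>F. ereal ((LINT y|\<nu>. f y) - (LINT x|\<rho>. f x)))"
    by (intro add_mono SUP_upper f)
  finally show "ereal ((LINT y|\<mu>. f y) - (LINT x|\<rho>. f x)) \<le> \<dots>" .
qed

lemma adv_dist_commute:
  assumes "F = (\<lambda>f x. - f x) ` F"
  shows "adv_dist F \<mu> \<nu> = adv_dist F \<nu> \<mu>"
proof -
  have "adv_dist F \<mu> \<nu> = adv_dist ((\<lambda>f x. - f x) ` F) \<mu> \<nu>"
    using assms by simp
  also have "\<dots> = adv_dist F \<nu> \<mu>"
    by (simp add: adv_dist_def image_image)
  finally show ?thesis .
qed

text \<open>A single test function and its negation give gaps of opposite sign, so one of them is
  nonnegative.\<close>

lemma adv_dist_nonneg:
  assumes sym: "F = (\<lambda>f x. - f x) ` F" and "F \<noteq> {}"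
  shows "0 \<le> adv_dist F \<mu> \<nu>"
proof -
  obtain f where f: "f \<in> F" using \<open>F \<noteq> {}\<close> by blast
  let ?gap = "\<lambda>\<mu> \<nu>. ereal ((LINT y|\<mu>. f y) - (LINT x|\<nu>. f x))"
  have "?gap \<mu> \<nu> \<le> adv_dist F \<mu> \<nu>"
    unfolding adv_dist_def using f by (rule SUP_upper)
  moreover have "?gap \<nu> \<mu> \<le> adv_dist F \<mu> \<nu>"
    unfolding adv_dist_commute[OF sym, of \<mu> \<nu>] unfolding adv_dist_def using f by (rule SUP_upper)
  moreover have "0 \<le> ?gap \<mu> \<nu> \<or> 0 \<le> ?gap \<nu> \<mu>"
    by auto
  ultimately show ?thesis
    by (meson order_trans)
qed

theorem lemma23:
  fixes M :: "'a measure" and \<Omega> :: "'w measure"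
    and D\<^sub>G :: "'a measure set" and F\<^sub>D :: "('a \<Rightarrow> real) set"
    and \<nu> \<nu>\<^sub>n \<mu>\<^sub>n :: "'a measure"
    and n :: nat and X :: "nat \<Rightarrow> 'w \<Rightarrow> 'a"
    and est :: "(nat \<Rightarrow> 'a) \<Rightarrow> 'a measure" and \<omega> :: 'w
  assumes generators: "D\<^sub>G \<subseteq> space (prob_algebra M)"
    and target: "\<nu> \<in> space (prob_algebra M)"
    and sample_space: "prob_space \<Omega>"
    and samples_indep: "prob_space.indep_vars \<Omega> (\<lambda>_. M) X {..<n}"
    and samples_distr: "\<And>i. i < n \<Longrightarrow> distr \<Omega> M (X i) = \<nu>"
    and estimator: "est \<in> space (PiM {..<n} (\<lambda>_. M)) \<rightarrow> space (prob_algebra M)"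
    and realization: "\<omega> \<in> space \<Omega>"
    and estimate: "\<nu>\<^sub>n = est (\<lambda>i\<in>{..<n}. X i \<omega>)"
    and integrable_generators: "\<And>f \<mu>. f \<in> F\<^sub>D \<Longrightarrow> \<mu> \<in> D\<^sub>G \<Longrightarrow> integrable \<mu> f"
    and integrable_target: "\<And>f. f \<in> F\<^sub>D \<Longrightarrow> integrable \<nu> f"
    and integrable_estimate: "\<And>f. f \<in> F\<^sub>D \<Longrightarrow> integrable \<nu>\<^sub>n f"
    and minimizer:
      "is_arg_min (\<lambda>\<mu>. SUP f\<in>F\<^sub>D. ereal ((LINT y|\<mu>. f y) - (LINT x|\<nu>\<^sub>n. f x))) (\<lambda>\<mu>. \<mu> \<in> D\<^sub>G) \<mu>\<^sub>n"
    and symmetric: "F\<^sub>D = (\<lambda>f x. - f x) ` F\<^sub>D"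
  shows "adv_dist F\<^sub>D \<nu> \<mu>\<^sub>n \<le> (INF \<mu>\<in>D\<^sub>G. adv_dist F\<^sub>D \<mu> \<nu>) + 2 * adv_dist F\<^sub>D \<nu> \<nu>\<^sub>n"
proof (cases "F\<^sub>D = {}")
  case True
  then show ?thesis
    by (simp add: adv_dist_def bot_ereal_def)
next
  case False
  let ?d = "adv_dist F\<^sub>D"
  note nonneg = adv_dist_nonneg[OF symmetric False]
  have "\<mu>\<^sub>n \<in> D\<^sub>G"
    using minimizer by (simp add: is_arg_min_def)
  have optimal: "?d \<mu>\<^sub>n \<nu>\<^sub>n \<le> ?d \<mu> \<nu>\<^sub>n" if "\<mu> \<in> D\<^sub>G" for \<mu>
    using minimizer that by (simp add: is_arg_min_linorder adv_dist_def)
  have "?d \<nu> \<mu>\<^sub>n \<le> ?d \<mu> \<nu> + 2 * ?d \<nu> \<nu>\<^sub>n" if "\<mu> \<in> D\<^sub>G" for \<mu>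
  proof -
    have "?d \<nu> \<mu>\<^sub>n \<le> ?d \<nu> \<nu>\<^sub>n + ?d \<nu>\<^sub>n \<mu>\<^sub>n"
      by (rule adv_dist_triangle)
    also have "?d \<nu>\<^sub>n \<mu>\<^sub>n = ?d \<mu>\<^sub>n \<nu>\<^sub>n"
      by (rule adv_dist_commute[OF symmetric])
    also have "?d \<mu>\<^sub>n \<nu>\<^sub>n \<le> ?d \<mu> \<nu> + ?d \<nu> \<nu>\<^sub>n"
      using optimal[OF that] adv_dist_triangle by (rule order_trans)
    also have "?d \<nu> \<nu>\<^sub>n + (?d \<mu> \<nu> + ?d \<nu> \<nu>\<^sub>n) = ?d \<mu> \<nu> + 2 * ?d \<nu> \<nu>\<^sub>n"
      using nonneg[of \<nu> \<nu>\<^sub>n] nonneg[of \<mu> \<nu>]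
      by (cases "?d \<nu> \<nu>\<^sub>n"; cases "?d \<mu> \<nu>") auto
    finally show ?thesis
      by (simp add: add_left_mono)
  qed
  then have "?d \<nu> \<mu>\<^sub>n \<le> (INF \<mu>\<in>D\<^sub>G. ?d \<mu> \<nu> + 2 * ?d \<nu> \<nu>\<^sub>n)"
    by (rule INF_greatest)
  also have "\<dots> = (INF \<mu>\<in>D\<^sub>G. ?d \<mu> \<nu>) + 2 * ?d \<nu> \<nu>\<^sub>n"
    using \<open>\<mu>\<^sub>n \<in> D\<^sub>G\<close> nonneg nonneg[of \<nu> \<nu>\<^sub>n]
    by (intro INF_ereal_add_left) (auto simp: zero_le_mult_iff)
  finally show ?thesis .
qed

end
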